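(* Let $G$ be a connected graph of order $n$ and size $m$, and let $\nu'_1$ and $\nu'_n$ denote respectively the maximum and the minimum of the numbers $|\mu'_i-\zeta(G)/n|$, $i=1,\dots,n$. Then \[LE_\varepsilon(G)\ge\frac{1}{\nu'_1+\nu'_n}\Big[E_1(G)-\frac{\zeta(G)^2}{n}+2m-n\nu'_1\nu'_n\Big].\]
   Context: $G$ is simple with vertices $v_1,\dots,v_n$. $\varepsilon_G(v)=\max_{u} d_G(u,v)$ is the eccentricity ($d_G$ = shortest-path distance); $\zeta(G)=\sum_i\varepsilon_G(v_i)$; $E_1(G)=\sum_i\varepsilon_G(v_i)^2$. $\mu'_1,\dots,\mu'_n$ are the eigenvalues of $L_\varepsilon(G)=\varepsilon(G)-A(G)$, where $A(G)$ is the adjacency matrix and $\varepsilon(G)$ the diagonal matrix with entries $\varepsilon_G(v_i)$. $LE_\varepsilon(G)=\sum_{i=1}^n|\mu'_i-\zeta(G)/n|$. *)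

theory Defs
  imports
    Jordan_Normal_Form.Char_Poly
    Jordan_Normal_Form.Conjugate
    "HOL-Library.Multiset"
    Graph_Theory.Graph_Theory
begin

text \<open>
  A simple graph is a digraph satisfying the locale \<^locale>\<open>graph\<close>: finite, loop-free, without
  parallel arcs, and with a symmetric arc relation. Each undirected edge is a pair of opposite
  arcs, so that the size of the graph counts the unordered pairs of adjacent vertices.
\<close>

definition edge_set :: "('a, 'b) pre_digraph \<Rightarrow> 'a set set" where
  "edge_set G = {{u, v} | u v. u \<rightarrow>\<^bsub>G\<^esub> v}"

text \<open>
  The weighted distance \<open>wf_digraph.\<mu>\<close> with unit weights is the least length of a walk; it is
  infinite only when there is no walk, so the conversion to \<^typ>\<open>real\<close> is harmless in
  connected graphs.
\<close>

definition graph_dist :: "('a, 'b) pre_digraph \<Rightarrow> 'a \<Rightarrow> 'a \<Rightarrow> real" where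
  "graph_dist G u v = real_of_ereal (wf_digraph.\<mu> G (\<lambda>_. 1) u v)"

definition ecc :: "('a, 'b) pre_digraph \<Rightarrow> 'a \<Rightarrow> real" where
  "ecc G v = Max ((\<lambda>u. graph_dist G u v) ` verts G)"

definition total_ecc :: "('a, 'b) pre_digraph \<Rightarrow> real" where
  "total_ecc G = (\<Sum>v\<in>verts G. ecc G v)"

definition zagreb_ecc :: "('a, 'b) pre_digraph \<Rightarrow> real" where
  "zagreb_ecc G = (\<Sum>v\<in>verts G. (ecc G v)\<^sup>2)"

text \<open>
  Matrices are taken with respect to an enumeration \<open>vs\<close> of the vertices.
\<close>

definition adj_matrix :: "('a, 'b) pre_digraph \<Rightarrow> 'a list \<Rightarrow> real mat" where
  "adj_matrix G vs = mat (length vs) (length vs) (\<lambda>(i, j). if vs ! i \<rightarrow>\<^bsub>G\<^esub> vs ! j then 1 else 0)"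

definition ecc_matrix :: "('a, 'b) pre_digraph \<Rightarrow> 'a list \<Rightarrow> real mat" where
  "ecc_matrix G vs = mat (length vs) (length vs) (\<lambda>(i, j). if i = j then ecc G (vs ! i) else 0)"

definition ecc_laplacian :: "('a, 'b) pre_digraph \<Rightarrow> 'a list \<Rightarrow> real mat" where
  "ecc_laplacian G vs = ecc_matrix G vs - adj_matrix G vs"

text \<open>
  The eigenvalues, with multiplicity, are the real roots of the characteristic polynomial. As the
  matrix is symmetric, none are lost by working over the reals; see the lemma
  \<open>size_ecc_laplacian_eigvals\<close> below.
\<close>

definition ecc_laplacian_eigvals :: "('a, 'b) pre_digraph \<Rightarrow> 'a list \<Rightarrow> real multiset" where
  "ecc_laplacian_eigvals G vs = proots (char_poly (ecc_laplacian G vs))"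

definition ecc_deviations :: "('a, 'b) pre_digraph \<Rightarrow> 'a list \<Rightarrow> real multiset" where
  "ecc_deviations G vs =
     {# \<bar>\<mu> - total_ecc G / real (length vs)\<bar>. \<mu> \<in># ecc_laplacian_eigvals G vs #}"

definition ecc_laplacian_energy :: "('a, 'b) pre_digraph \<Rightarrow> 'a list \<Rightarrow> real" where
  "ecc_laplacian_energy G vs = \<Sum>\<^sub># (ecc_deviations G vs)"

lemma symmetric_real_size_proots:
  fixes A :: "real mat"
  assumes A: "A \<in> carrier_mat n n"
    and sym: "\<And>i j. i < n \<Longrightarrow> j < n \<Longrightarrow> A $$ (i, j) = A $$ (j, i)"
  shows "size (proots (char_poly A)) = n"
proof -
  let ?h = "complex_of_real"
  let ?B = "map_mat ?h A"
  have B: "?B \<in> carrier_mat n n" using A by simp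
  from char_poly_factorized[OF B] obtain as where
    cB: "char_poly ?B = (\<Prod>a\<leftarrow>as. [:- a, 1:])" and len: "length as = n" by auto
  have real: "?h (Re a) = a" if "a \<in> set as" for a
  proof -
    have "poly (char_poly ?B) a = 0"
      using that unfolding cB by (auto simp: poly_prod_list prod_list_zero_iff)
    with eigenvalue_root_char_poly[OF B] have "eigenvalue ?B a" by simp
    then obtain v where v: "v \<in> carrier_vec n" "v \<noteq> 0\<^sub>v n" and ev: "?B *\<^sub>v v = a \<cdot>\<^sub>v v"
      using B unfolding eigenvalue_def eigenvector_def by auto
    let ?s = "\<Sum>i<n. v $ i * cnj (v $ i)"
    have row: "(\<Sum>j<n. ?h (A $$ (i, j)) * v $ j) = a * v $ i" if "i < n" for i
    proof -
      have "(?B *\<^sub>v v) $ i = a * v $ i" using ev v that by simp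
      then show ?thesis using that A v
        by (simp add: scalar_prod_def atLeast0LessThan)
    qed
    have "a * ?s = (\<Sum>i<n. (\<Sum>j<n. ?h (A $$ (i, j)) * v $ j) * cnj (v $ i))"
      by (simp add: row sum_distrib_left mult.assoc)
    also have "\<dots> = (\<Sum>i<n. \<Sum>j<n. ?h (A $$ (i, j)) * v $ j * cnj (v $ i))"
      by (simp add: sum_distrib_right)
    also have "\<dots> = (\<Sum>j<n. \<Sum>i<n. ?h (A $$ (i, j)) * v $ j * cnj (v $ i))"
      by (rule sum.swap)
    also have "\<dots> = (\<Sum>j<n. v $ j * cnj (\<Sum>i<n. ?h (A $$ (j, i)) * v $ i))"
      by (simp add: sum_distrib_left sym ac_simps)
    also have "\<dots> = (\<Sum>j<n. v $ j * cnj (a * v $ j))"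
      by (intro sum.cong refl) (simp only: row lessThan_iff)
    also have "\<dots> = cnj a * ?s"
      by (simp add: sum_distrib_left ac_simps)
    finally have "a * ?s = cnj a * ?s" .
    moreover have "?s \<noteq> 0"
    proof
      assume "?s = 0"
      then have "?h (\<Sum>i<n. (cmod (v $ i))\<^sup>2) = 0"
        by (simp only: of_real_sum complex_norm_square)
      then have "(\<Sum>i<n. (cmod (v $ i))\<^sup>2) = 0" by (simp only: of_real_eq_0_iff)
      then have "v $ i = 0" if "i < n" for i
        using that by (simp add: sum_nonneg_eq_0_iff)
      then show False using v by auto
    qed
    ultimately have "cnj a = a" by simp
    then show ?thesis by (metis Reals_cnj_iff of_real_Re)
  qed
  interpret h: map_poly_inj_idom_hom ?h ..
  have "map_poly ?h (char_poly A) = (\<Prod>a\<leftarrow>as. [:- a, 1:])"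
    using of_real_hom.char_poly_hom[OF A, where 'a = complex] cB by simp
  also have "\<dots> = (\<Prod>a\<leftarrow>as. map_poly ?h [:- Re a, 1:])"
    by (rule arg_cong[where f = prod_list], rule map_cong) (auto simp: real)
  also have "\<dots> = map_poly ?h (\<Prod>a\<leftarrow>as. [:- Re a, 1:])"
    by (simp add: h.hom_prod_list o_def)
  finally have cA: "char_poly A = (\<Prod>a\<leftarrow>as. [:- Re a, 1:])" by simp
  have "size (proots (\<Prod>a\<leftarrow>bs. [:- Re a, 1:])) = length bs" for bs :: "complex list"
  proof (induction bs)
    case (Cons b bs)
    have "(\<Prod>a\<leftarrow>bs. [:- Re a, 1:]) \<noteq> 0" by (auto simp: prod_list_zero_iff)
    then have "proots ([:- Re b, 1:] * (\<Prod>a\<leftarrow>bs. [:- Re a, 1:])) =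
        proots [:- Re b, 1:] + proots (\<Prod>a\<leftarrow>bs. [:- Re a, 1:])"
      by (intro proots_mult) auto
    then show ?case using Cons by simp
  qed simp
  then show ?thesis using cA len by simp
qed

lemma size_ecc_laplacian_eigvals:
  assumes "graph G"
  shows "size (ecc_laplacian_eigvals G vs) = length vs"
proof -
  interpret graph G by fact
  have "ecc_laplacian G vs $$ (i, j) = ecc_laplacian G vs $$ (j, i)"
    if "i < length vs" "j < length vs" for i j
    using that sym_arcs
    by (auto simp: ecc_laplacian_def ecc_matrix_def adj_matrix_def symmetric_def dest: symD)
  then show ?thesis unfolding ecc_laplacian_eigvals_def
    by (intro symmetric_real_size_proots)
      (auto simp: ecc_laplacian_def ecc_matrix_def adj_matrix_def)
qed

end

theory Submission
  imports Defs Jordan_Normal_Form.Schur_Decomposition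
begin

text \<open>
  Every deviation \<open>d\<close> lies between \<open>\<nu>\<^sub>n\<close> and \<open>\<nu>\<^sub>1\<close>, so \<open>(\<nu>\<^sub>1 - d) (d - \<nu>\<^sub>n) \<ge> 0\<close>. Summing over all
  deviations gives \<open>(\<nu>\<^sub>1 + \<nu>\<^sub>n) LE \<ge> \<Sum> d\<^sup>2 + n \<nu>\<^sub>1 \<nu>\<^sub>n\<close>, which is even stronger than the claim in the
  last sign. The sum of the squares is \<open>E\<^sub>1 - \<zeta>\<^sup>2 / n + 2 m\<close>, because the eigenvalues of a real
  symmetric matrix \<open>L\<close> have sum \<open>tr L\<close> and sum of squares \<open>tr L\<^sup>2\<close>, as a Schur decomposition shows.
\<close>

section \<open>Traces and eigenvalues\<close>

definition mat_trace :: "'a :: comm_monoid_add mat \<Rightarrow> 'a" where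
  "mat_trace A = (\<Sum>i<dim_row A. A $$ (i, i))"

lemma mat_trace_eq_sum_list_diag: "mat_trace A = sum_list (diag_mat A)"
  by (simp add: mat_trace_def diag_mat_def interv_sum_list_conv_sum_set_nat atLeast0LessThan)

lemma mat_trace_mult:
  assumes "A \<in> carrier_mat n k" "B \<in> carrier_mat k n"
  shows "mat_trace (A * B) = (\<Sum>i<n. \<Sum>j<k. A $$ (i, j) * B $$ (j, i))"
  using assms by (simp add: mat_trace_def scalar_prod_def atLeast0LessThan)

lemma mat_trace_mult_commute:
  fixes A B :: "'a :: comm_semiring_0 mat"
  assumes "A \<in> carrier_mat n k" "B \<in> carrier_mat k n"
  shows "mat_trace (A * B) = mat_trace (B * A)"
  unfolding mat_trace_mult[OF assms] mat_trace_mult[OF assms(2,1)]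
  by (subst sum.swap) (simp add: mult.commute)

text \<open>Cyclicity of the trace brings \<open>Q\<close> next to \<open>P\<close>, and
  \<open>Q * P\<close> is the identity.\<close>

lemma mat_trace_similar:
  fixes A B :: "'a :: comm_semiring_1 mat"
  assumes "similar_mat_wit A B P Q"
  shows "mat_trace A = mat_trace B"
proof -
  define n where "n = dim_row A"
  note w = similar_mat_witD[OF n_def assms]
  have "mat_trace A = mat_trace (P * (B * Q))"
    using w by (simp add: assoc_mult_mat[of _ n n _ n _ n])
  also have "\<dots> = mat_trace (B * Q * P)"
    using w by (intro mat_trace_mult_commute) auto
  also have "B * Q * P = B"
    using w by (simp add: assoc_mult_mat[of _ n n _ n _ n])
  finally show ?thesis .
qed

text \<open>The inner \<open>Q * P\<close> cancels in the square, so the trace of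
  \<open>A * A\<close> can be computed from \<open>B * B\<close>.\<close>

lemma similar_mat_wit_square:
  fixes A B :: "'a :: semiring_1 mat"
  assumes "similar_mat_wit A B P Q"
  shows "similar_mat_wit (A * A) (B * B) P Q"
proof -
  define n where "n = dim_row A"
  note w = similar_mat_witD[OF n_def assms]
  have square: "X ^\<^sub>m 2 = X * X" if "X \<in> carrier_mat n n" for X :: "'a mat"
    using that by (simp add: numeral_2_eq_2)
  show ?thesis
    using similar_mat_wit_pow[OF assms, of 2] unfolding square[OF w(4)] square[OF w(5)] .
qed

text \<open>For distinct \<open>i\<close> and \<open>j\<close>, one of the positions
  \<open>(i, j)\<close> and \<open>(j, i)\<close> is below the diagonal, so only the products of
  diagonal entries survive.\<close>

lemma mat_trace_square_upper_triangular:
  fixes B :: "'a :: comm_semiring_1 mat"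
  assumes "B \<in> carrier_mat n n" "upper_triangular B"
  shows "mat_trace (B * B) = (\<Sum>i<n. (B $$ (i, i))\<^sup>2)"
proof -
  have "B $$ (i, j) * B $$ (j, i) = (if j = i then (B $$ (i, i))\<^sup>2 else 0)"
    if "i < n" "j < n" for i j
    using that assms upper_triangularD[of B i j] upper_triangularD[of B j i]
    by (cases i j rule: linorder_cases) (auto simp: power2_eq_square)
  then show ?thesis
    by (simp add: mat_trace_mult[OF assms(1,1)])
qed

section \<open>Polynomials that split into linear factors\<close>

text \<open>Each root splits off a linear factor and so leaves the multiset of roots once; the
  induction is on the number of roots.\<close>

lemma proots_factorization:
  fixes p :: "'a :: idom poly"
  assumes "p \<noteq> 0"
  shows "\<exists>q. p = (\<Prod>a\<in>#proots p. [:- a, 1:]) * q"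
  using assms
proof (induction "size (proots p)" arbitrary: p)
  case 0
  then show ?case by simp
next
  case (Suc k)
  then obtain a where "a \<in># proots p"
    by (metis multiset_nonemptyE size_empty nat.distinct(1))
  then have "poly p a = 0" using Suc.prems by simp
  then obtain q where q: "p = [:- a, 1:] * q"
    by (auto simp: poly_eq_0_iff_dvd)
  with Suc.prems have "q \<noteq> 0" by auto
  then have roots: "proots p = add_mset a (proots q)"
    unfolding q by (subst proots_mult) auto
  with Suc \<open>q \<noteq> 0\<close> obtain r where r: "q = (\<Prod>a\<in>#proots q. [:- a, 1:]) * r"
    by (metis size_add_mset nat.inject)
  have "p = [:- a, 1:] * ((\<Prod>a\<in>#proots q. [:- a, 1:]) * r)"
    unfolding q by (rule arg_cong[OF r])
  also have "\<dots> = (\<Prod>a\<in>#proots p. [:- a, 1:]) * r"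
    by (simp only: roots image_mset_add_mset prod_mset.add_mset mult.assoc)
  finally show ?case ..
qed

text \<open>With as many roots as its degree, \<open>p\<close> leaves a cofactor of degree 0;
  comparing leading coefficients makes it 1.\<close>

lemma monic_eq_prod_proots:
  fixes p :: "'a :: idom poly"
  assumes "monic p" "size (proots p) = degree p"
  shows "p = (\<Prod>a\<in>#proots p. [:- a, 1:])"
proof -
  let ?r = "\<Prod>a\<in>#proots p. [:- a, 1:]"
  have r: "monic (\<Prod>a\<in>#M. [:- a, 1:]) \<and> degree (\<Prod>a\<in>#M. [:- a, 1:]) = size M"
    for M :: "'a multiset"
  proof (induction M)
    case (add a M)
    then have "(\<Prod>a\<in>#M. [:- a, 1:]) \<noteq> 0" by auto
    with add have "degree ([:- a, 1:] * (\<Prod>a\<in>#M. [:- a, 1:])) = Suc (size M)"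
      by (subst degree_mult_eq) auto
    moreover have "monic ([:- a, 1:] * (\<Prod>a\<in>#M. [:- a, 1:]))"
      using add by (intro monic_mult) auto
    ultimately show ?case by simp
  qed simp
  have p0: "p \<noteq> 0" using assms(1) by auto
  from proots_factorization[OF this] obtain q where q: "p = ?r * q" by blast
  with p0 have "degree p = degree ?r + degree q"
    by (metis degree_mult_eq mult_eq_0_iff)
  then have "degree q = 0" using assms(2) r[of "proots p"] by simp
  moreover have "lead_coeff p = lead_coeff ?r * lead_coeff q"
    by (rule trans[OF arg_cong[OF q, of lead_coeff] lead_coeff_mult])
  then have "lead_coeff q = 1" using assms(1) r[of "proots p"] by (metis mult_1)
  ultimately have "q = 1" by (metis monic_degree_0)
  with q show ?thesis by simp
qed

section \<open>Power sums of the eigenvalues of a real symmetric matrix\<close>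

lemma symmetric_real_sum_proots:
  fixes A :: "real mat"
  assumes A: "A \<in> carrier_mat n n"
    and sym: "\<And>i j. i < n \<Longrightarrow> j < n \<Longrightarrow> A $$ (i, j) = A $$ (j, i)"
  shows "\<Sum>\<^sub># (proots (char_poly A)) = mat_trace A" (is ?sum)
    and "(\<Sum>a\<in>#proots (char_poly A). a\<^sup>2) = (\<Sum>i<n. \<Sum>j<n. (A $$ (i, j))\<^sup>2)" (is ?squares)
proof -
  \<comment> \<open>The Schur decomposition takes the eigenvalues as a list and puts them on the
    diagonal of \<open>B\<close> in that order. Symmetry of \<open>A\<close> ensures that the real
    roots already exhaust the characteristic polynomial.\<close>
  obtain es where es: "mset es = proots (char_poly A)" using ex_mset by blast
  have "char_poly A = (\<Prod>a\<in>#proots (char_poly A). [:- a, 1:])"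
    using degree_monic_char_poly[OF A] symmetric_real_size_proots[OF assms]
    by (intro monic_eq_prod_proots) auto
  then have linear: "char_poly A = (\<Prod>a\<leftarrow>es. [:- a, 1:])"
    unfolding es[symmetric] mset_map[symmetric] prod_mset_prod_list .
  obtain B P Q where schur: "schur_decomposition A es = (B, P, Q)"
    by (cases "schur_decomposition A es")
  from schur_decomposition[OF A linear schur] have wit: "similar_mat_wit A B P Q"
    and ut: "upper_triangular B" and diag: "diag_mat B = es" by auto
  have B: "B \<in> carrier_mat n n" using similar_mat_witD2[OF A wit] by simp
  show ?sum
    using mat_trace_similar[OF wit]
    by (simp add: mat_trace_eq_sum_list_diag diag es[symmetric] sum_mset_sum_list)
  have "(\<Sum>a\<in>#proots (char_poly A). a\<^sup>2) = sum_list (map (\<lambda>a. a\<^sup>2) (diag_mat B))"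
    unfolding es[symmetric] diag mset_map[symmetric] sum_mset_sum_list ..
  also have "\<dots> = (\<Sum>i<n. (B $$ (i, i))\<^sup>2)"
    using B by (simp add: diag_mat_def comp_def interv_sum_list_conv_sum_set_nat atLeast0LessThan)
  also have "\<dots> = mat_trace (A * A)"
    using mat_trace_square_upper_triangular[OF B ut]
      mat_trace_similar[OF similar_mat_wit_square[OF wit]] by simp
  \<comment> \<open>The trace of \<open>A * A\<close> sums \<open>A $$ (i, j) * A $$ (j, i)\<close>,
    which is a square by symmetry.\<close>
  also have "\<dots> = (\<Sum>i<n. \<Sum>j<n. (A $$ (i, j))\<^sup>2)"
    unfolding mat_trace_mult[OF A A]
    by (intro sum.cong refl) (simp add: sym power2_eq_square)
  finally show ?squares .
qed

section \<open>The eccentricity Laplacian\<close>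

text \<open>Count \<open>R\<close> by the fibres of the map from \<open>(u, v)\<close> to
  \<open>{u, v}\<close>: symmetry puts both orders into the fibre, and irreflexivity makes them
  distinct.\<close>

lemma card_symmetric_irreflexive:
  assumes "finite R" "sym R" "irrefl R"
  shows "card R = 2 * card {{u, v} | u v. (u, v) \<in> R}"
proof -
  let ?E = "{{u, v} | u v. (u, v) \<in> R}"
  let ?F = "\<lambda>e. {p \<in> R. {fst p, snd p} = e}"
  have E: "?E = (\<lambda>p. {fst p, snd p}) ` R"
    by (simp only: image_def Bex_def split_paired_Ex fst_conv snd_conv conj_commute)
  have "card (?F e) = 2" if "e \<in> ?E" for e
  proof -
    from that obtain u v where e: "e = {u, v}" and uv: "(u, v) \<in> R" by blast
    have "?F e = {(u, v), (v, u)}"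
      using uv symD[OF assms(2) uv] by (auto simp: e doubleton_eq_iff)
    moreover have "u \<noteq> v" using uv assms(3) by (auto simp: irrefl_def)
    ultimately show ?thesis by simp
  qed
  moreover have "card R = (\<Sum>e\<in>?E. card (?F e))"
    unfolding card_eq_sum E using assms(1) by (rule sum.image_gen)
  ultimately show ?thesis by simp
qed

lemma (in graph) sum_adjacent:
  "(\<Sum>u\<in>verts G. \<Sum>v\<in>verts G. if u \<rightarrow>\<^bsub>G\<^esub> v then 1 else 0) = 2 * real (card (edge_set G))"
proof -
  have "(\<Sum>u\<in>verts G. \<Sum>v\<in>verts G. if u \<rightarrow>\<^bsub>G\<^esub> v then 1 else (0 :: real)) =
      (\<Sum>p\<in>verts G \<times> verts G. if p \<in> arcs_ends G then 1 else 0)"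
    by (simp only: sum.cartesian_product case_prod_unfold prod.collapse)
  also have "\<dots> = real (card ((verts G \<times> verts G) \<inter> arcs_ends G))"
    by (simp add: sum.If_cases)
  also have "(verts G \<times> verts G) \<inter> arcs_ends G = arcs_ends G"
    by (auto dest: adj_in_verts)
  also have "card (arcs_ends G) = 2 * card (edge_set G)"
    unfolding edge_set_def
  proof (rule card_symmetric_irreflexive)
    show "finite (arcs_ends G)" by (simp add: arcs_ends_def)
    show "sym (arcs_ends G)" using sym_arcs by (simp add: symmetric_def)
    show "irrefl (arcs_ends G)" using adj_not_same by (auto simp: irrefl_def)
  qed
  finally show ?thesis by simp
qed

section \<open>Spectral moments of the eccentricity Laplacian\<close>

lemma sum_nth_distinct:
  assumes "distinct vs"
  shows "(\<Sum>i<length vs. f (vs ! i)) = sum f (set vs)"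
  by (rule sum.reindex_bij_betw[OF bij_betw_nth[OF assms refl refl]])

lemma ecc_laplacian_carrier: "ecc_laplacian G vs \<in> carrier_mat (length vs) (length vs)"
  by (simp add: ecc_laplacian_def ecc_matrix_def adj_matrix_def minus_carrier_mat)

lemma ecc_laplacian_index:
  assumes "i < length vs" "j < length vs"
  shows "ecc_laplacian G vs $$ (i, j) =
    (if i = j then ecc G (vs ! i) else 0) - (if vs ! i \<rightarrow>\<^bsub>G\<^esub> vs ! j then 1 else 0)"
  using assms by (simp add: ecc_laplacian_def ecc_matrix_def adj_matrix_def)

context
  fixes G :: "('a, 'b) pre_digraph" and vs :: "'a list"
  assumes graph: "graph G" and dist: "distinct vs" and vs: "set vs = verts G"
begin

interpretation graph G by (rule graph)

lemma ecc_laplacian_sym: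
  assumes "i < length vs" "j < length vs"
  shows "ecc_laplacian G vs $$ (i, j) = ecc_laplacian G vs $$ (j, i)"
  using assms sym_arcs by (auto simp: ecc_laplacian_index symmetric_def dest: symD)

lemma sum_ecc_laplacian_eigvals: "\<Sum>\<^sub># (ecc_laplacian_eigvals G vs) = total_ecc G"
proof -
  have "\<Sum>\<^sub># (ecc_laplacian_eigvals G vs) = mat_trace (ecc_laplacian G vs)"
    unfolding ecc_laplacian_eigvals_def
    by (rule symmetric_real_sum_proots(1)[OF ecc_laplacian_carrier ecc_laplacian_sym])
  \<comment> \<open>There are no loops, so the adjacency matrix contributes nothing to the
    diagonal.\<close>
  also have "\<dots> = (\<Sum>i<length vs. ecc G (vs ! i))"
    unfolding mat_trace_def using ecc_laplacian_carrier[of G vs] adj_not_same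
    by (intro sum.cong) (auto simp: ecc_laplacian_index)
  finally show ?thesis
    using sum_nth_distinct[OF dist] by (simp add: total_ecc_def vs)
qed

lemma sum_squares_ecc_laplacian_eigvals:
  "(\<Sum>\<mu>\<in>#ecc_laplacian_eigvals G vs. \<mu>\<^sup>2) = zagreb_ecc G + 2 * real (card (edge_set G))"
proof -
  let ?n = "length vs" and ?a = "\<lambda>u v. if u \<rightarrow>\<^bsub>G\<^esub> v then 1 else (0 :: real)"
  have "(\<Sum>\<mu>\<in>#ecc_laplacian_eigvals G vs. \<mu>\<^sup>2) =
      (\<Sum>i<?n. \<Sum>j<?n. (ecc_laplacian G vs $$ (i, j))\<^sup>2)"
    unfolding ecc_laplacian_eigvals_def
    by (rule symmetric_real_sum_proots(2)[OF ecc_laplacian_carrier ecc_laplacian_sym])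
  \<comment> \<open>Eccentricities sit on the diagonal and adjacencies off it, so squaring an entry
    produces no cross term, and the sign of the adjacency part disappears.\<close>
  also have "\<dots> = (\<Sum>i<?n. \<Sum>j<?n. (if j = i then (ecc G (vs ! i))\<^sup>2 else 0) + ?a (vs ! i) (vs ! j))"
  proof (intro sum.cong refl)
    fix i j
    assume ij: "i \<in> {..<?n}" "j \<in> {..<?n}"
    have "\<not> vs ! i \<rightarrow>\<^bsub>G\<^esub> vs ! i" using adj_not_same by blast
    with ij show "(ecc_laplacian G vs $$ (i, j))\<^sup>2 =
        (if j = i then (ecc G (vs ! i))\<^sup>2 else 0) + ?a (vs ! i) (vs ! j)"
      by (cases "i = j") (simp_all add: ecc_laplacian_index)
  qed
  also have "\<dots> = (\<Sum>i<?n. (ecc G (vs ! i))\<^sup>2) + (\<Sum>i<?n. \<Sum>j<?n. ?a (vs ! i) (vs ! j))"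
    by (simp add: sum.distrib)
  also have "(\<Sum>i<?n. (ecc G (vs ! i))\<^sup>2) = zagreb_ecc G"
    using sum_nth_distinct[OF dist, of "\<lambda>v. (ecc G v)\<^sup>2"] by (simp add: zagreb_ecc_def vs)
  also have "(\<Sum>i<?n. \<Sum>j<?n. ?a (vs ! i) (vs ! j)) = (\<Sum>u\<in>verts G. \<Sum>v\<in>verts G. ?a u v)"
    by (simp only: sum_nth_distinct[OF dist, of "?a _"] vs
        sum_nth_distinct[OF dist, of "\<lambda>u. \<Sum>v\<in>verts G. ?a u v"])
  finally show ?thesis by (simp only: sum_adjacent)
qed

text \<open>Squaring removes the absolute values; what remains is the variance identity for the
  eigenvalues around \<open>c\<close>, their mean when \<open>vs\<close> is nonempty.\<close>

lemma sum_squares_ecc_deviations: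
  "(\<Sum>d\<in>#ecc_deviations G vs. d\<^sup>2) =
    zagreb_ecc G - (total_ecc G)\<^sup>2 / real (length vs) + 2 * real (card (edge_set G))"
proof -
  let ?n = "real (length vs)" and ?M = "ecc_laplacian_eigvals G vs"
  define c where "c = total_ecc G / ?n"
  have "(\<Sum>\<mu>\<in>#M. (\<mu> - c)\<^sup>2) = (\<Sum>\<mu>\<in>#M. \<mu>\<^sup>2) - 2 * c * \<Sum>\<^sub># M + real (size M) * c\<^sup>2" for M
    by (induction M) (simp_all add: power2_eq_square algebra_simps)
  moreover have "(\<Sum>d\<in>#ecc_deviations G vs. d\<^sup>2) = (\<Sum>\<mu>\<in>#?M. (\<mu> - c)\<^sup>2)"
    by (simp add: ecc_deviations_def image_mset.compositionality comp_def c_def)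
  ultimately have "(\<Sum>d\<in>#ecc_deviations G vs. d\<^sup>2) =
      zagreb_ecc G + 2 * real (card (edge_set G)) - 2 * c * total_ecc G + ?n * c\<^sup>2"
    by (simp only: sum_squares_ecc_laplacian_eigvals sum_ecc_laplacian_eigvals
        size_ecc_laplacian_eigvals[OF graph])
  \<comment> \<open>For empty \<open>vs\<close> both equations read 0 = 0, since division by 0
    yields 0.\<close>
  moreover have "?n * c\<^sup>2 = (total_ecc G)\<^sup>2 / ?n" "c * total_ecc G = (total_ecc G)\<^sup>2 / ?n"
    by (simp_all add: c_def power2_eq_square)
  ultimately show ?thesis by simp
qed

end

section \<open>The energy bound\<close>

theorem theorem3:
  fixes G :: "('a, 'b) pre_digraph" and vs :: "'a list" and n m :: nat and \<nu>\<^sub>1 \<nu>\<^sub>n :: real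
  assumes "graph G" and "Digraph_Component.connected G"
    and "distinct vs" and "set vs = verts G"
    and "n = card (verts G)" and "m = card (edge_set G)"
    and "\<nu>\<^sub>1 = Max (set_mset (ecc_deviations G vs))"
    and "\<nu>\<^sub>n = Min (set_mset (ecc_deviations G vs))"
  shows "ecc_laplacian_energy G vs \<ge>
    1 / (\<nu>\<^sub>1 + \<nu>\<^sub>n) *
      (zagreb_ecc G - (total_ecc G)\<^sup>2 / real n + 2 * real m - real n * \<nu>\<^sub>1 * \<nu>\<^sub>n)"
proof -
  let ?D = "ecc_deviations G vs"
  have n: "n = length vs"
    using assms(3-5) by (metis distinct_card)
  \<comment> \<open>Connectedness includes having a vertex, so the maximum and the minimum below are
    attained.\<close>
  have "verts G \<noteq> {}"
    using assms(2) by (auto simp: Digraph_Component.connected_def strongly_connected_def)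
  then have "n > 0" using assms(4) n by auto
  have size: "size ?D = n"
    by (simp add: ecc_deviations_def size_ecc_laplacian_eigvals[OF assms(1)] n)
  with \<open>n > 0\<close> have ne: "set_mset ?D \<noteq> {}" by auto
  have nonneg: "d \<ge> 0" if "d \<in># ?D" for d
    using that by (auto simp: ecc_deviations_def)
  have bounds: "\<nu>\<^sub>n \<le> d" "d \<le> \<nu>\<^sub>1" if "d \<in># ?D" for d
    using that by (simp_all add: assms(7,8))
  have \<nu>: "\<nu>\<^sub>1 \<ge> 0" "\<nu>\<^sub>n \<ge> 0"
    using nonneg Max_in[OF finite_set_mset ne] Min_in[OF finite_set_mset ne]
    by (simp_all add: assms(7,8))
  \<comment> \<open>Submultisets \<open>M\<close> allow an induction in which the extreme values of
    the whole of \<open>?D\<close> stay fixed. Adding \<open>d\<close> preserves the inequality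
    because expanding \<open>(\<nu>\<^sub>1 - d) * (d - \<nu>\<^sub>n)\<close> bounds
    \<open>d\<^sup>2 + \<nu>\<^sub>1 * \<nu>\<^sub>n\<close> by
    \<open>(\<nu>\<^sub>1 + \<nu>\<^sub>n) * d\<close>.\<close>
  have "(\<Sum>d\<in>#M. d\<^sup>2) + real (size M) * \<nu>\<^sub>1 * \<nu>\<^sub>n \<le> (\<nu>\<^sub>1 + \<nu>\<^sub>n) * \<Sum>\<^sub># M" if "M \<subseteq># ?D" for M
    using that
  proof (induction M)
    case (add d M)
    then have "d \<in># ?D" by (auto dest: mset_subset_eqD)
    then have "0 \<le> (\<nu>\<^sub>1 - d) * (d - \<nu>\<^sub>n)" using bounds by simp
    moreover have "M \<subseteq># ?D" using add.prems by (metis mset_subset_eq_insertD subset_mset.less_imp_le)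
    ultimately show ?case using add.IH by (simp add: algebra_simps power2_eq_square)
  qed simp
  from this[of ?D] have "zagreb_ecc G - (total_ecc G)\<^sup>2 / real n + 2 * real m + real n * \<nu>\<^sub>1 * \<nu>\<^sub>n
      \<le> (\<nu>\<^sub>1 + \<nu>\<^sub>n) * ecc_laplacian_energy G vs"
    by (simp add: sum_squares_ecc_deviations[OF assms(1,3,4)] size n[symmetric] assms(6)
        ecc_laplacian_energy_def)
  moreover have "0 \<le> real n * \<nu>\<^sub>1 * \<nu>\<^sub>n" using \<nu> by simp
  ultimately have bound: "zagreb_ecc G - (total_ecc G)\<^sup>2 / real n + 2 * real m - real n * \<nu>\<^sub>1 * \<nu>\<^sub>n
      \<le> (\<nu>\<^sub>1 + \<nu>\<^sub>n) * ecc_laplacian_energy G vs" by linarith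
  show ?thesis
  proof (cases "\<nu>\<^sub>1 + \<nu>\<^sub>n = 0")
    case True
    \<comment> \<open>All eigenvalues equal \<open>\<zeta> / n\<close>; the right-hand side is then 0, since \<open>1 / 0 = 0\<close>.\<close>
    moreover have "0 \<le> \<Sum>\<^sub># M" if "\<And>d. d \<in># M \<Longrightarrow> 0 \<le> d" for M :: "real multiset"
      using that by (induction M) auto
    then have "0 \<le> ecc_laplacian_energy G vs"
      unfolding ecc_laplacian_energy_def using nonneg by blast
    ultimately show ?thesis by simp
  next
    case False
    then have "\<nu>\<^sub>1 + \<nu>\<^sub>n > 0" using \<nu> by simp
    with bound show ?thesis by (simp add: divide_le_eq mult.commute)
  qed
qed

end
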